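(* Let $k_1,k_2\in\mathbb{N}$ be fixed with $k_1<k_2$, let $p\in[1,\infty)$, and for each integer $n\ge k_2$ let $X_p^{(n)}\sim\mu_p^{(n)}$ be a random vector in $\mathbb{R}^n$. Then for any $c\in(0,1)$, $$\lim_{n\to\infty}\mathbb{P}\bigl[S^{(n)}_{k_2,p}(X_p^{(n)})\ge c\,S^{(n)}_{k_1,p}(X_p^{(n)})\bigr]=1.$$
   Context: For $x\in\mathbb{R}^n$ and $p\in[1,\infty)$ let $\|x\|_p=(\sum_{i=1}^n|x_i|^p)^{1/p}$, $\mathbb{B}_p^n=\{x\in\mathbb{R}^n:\|x\|_p\le1\}$, $\mathbb{S}_p^{n-1}=\{x\in\mathbb{R}^n:\|x\|_p=1\}$. Cone measure: $\mu_p^{(n)}(A)=\lambda^{(n)}(\{ra:r\in[0,1],a\in A\})/\lambda^{(n)}(\mathbb{B}_p^n)$ for Borel $A\subset\mathbb{S}_p^{n-1}$, with $\lambda^{(n)}$ Lebesgue measure. For $x\in\mathbb{R}^n$ and $1\le k\le n$ let $$S^{(n)}_{k,p}(x)=\Bigl(\tbinom{n}{k}^{-1}\sum_{1\le i_1<\dots<i_k\le n}|x_{i_1}|^p\cdots|x_{i_k}|^p\Bigr)^{1/(kp)}.$$ *)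

theory Defs
  imports "HOL-Probability.Probability"
begin

text \<open>
  Since the dimension varies, \<open>\<real>\<^sup>n\<close> is the space of extensional functions on \<open>{1..n}\<close>, which is
  the carrier of the product measure below. That measure lives on the Borel \<open>\<sigma>\<close>-algebra of \<open>\<real>\<^sup>n\<close>.
\<close>

definition lebesgue_n :: "nat \<Rightarrow> (nat \<Rightarrow> real) measure" where
  "lebesgue_n n = PiM {1..n} (\<lambda>_. lborel)"

definition p_norm :: "real \<Rightarrow> nat \<Rightarrow> (nat \<Rightarrow> real) \<Rightarrow> real" where
  "p_norm p n x = (\<Sum>i=1..n. \<bar>x i\<bar> powr p) powr (1 / p)"

definition p_ball :: "real \<Rightarrow> nat \<Rightarrow> (nat \<Rightarrow> real) set" where
  "p_ball p n = {x \<in> space (lebesgue_n n). p_norm p n x \<le> 1}"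

text \<open>The sphere in \<open>\<real>\<^sup>n\<close>; the parameter is the dimension of the ambient space.\<close>

definition p_sphere :: "real \<Rightarrow> nat \<Rightarrow> (nat \<Rightarrow> real) set" where
  "p_sphere p n = {x \<in> space (lebesgue_n n). p_norm p n x = 1}"

definition cone_over :: "nat \<Rightarrow> (nat \<Rightarrow> real) set \<Rightarrow> (nat \<Rightarrow> real) set" where
  "cone_over n A = {(\<lambda>i\<in>{1..n}. r * a i) | r a. r \<in> {0..1} \<and> a \<in> A}"

definition cone_measure :: "real \<Rightarrow> nat \<Rightarrow> (nat \<Rightarrow> real) measure" where
  "cone_measure p n =
     measure_of (p_sphere p n) (sets (restrict_space (lebesgue_n n) (p_sphere p n)))
       (\<lambda>A. emeasure (lebesgue_n n) (cone_over n A) / emeasure (lebesgue_n n) (p_ball p n))"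

text \<open>The index tuples \<open>i\<^sub>1 < \<dots> < i\<^sub>k\<close> are encoded as the \<open>k\<close>-element subsets of \<open>{1..n}\<close>.\<close>

definition sym_mean :: "real \<Rightarrow> nat \<Rightarrow> nat \<Rightarrow> (nat \<Rightarrow> real) \<Rightarrow> real" where
  "sym_mean p n k x =
     (inverse (real (n choose k)) *
       (\<Sum>I | I \<subseteq> {1..n} \<and> card I = k. \<Prod>i\<in>I. \<bar>x i\<bar> powr p)) powr (1 / (real k * p))"

text \<open>
  A random vector with values in \<open>\<real>\<^sup>n\<close> (not only in the sphere) whose law is the cone measure,
  viewed as a Borel measure on \<open>\<real>\<^sup>n\<close> by pushing it forward along the inclusion of the sphere.
\<close>

definition cone_distributed ::
    "'a measure \<Rightarrow> ('a \<Rightarrow> nat \<Rightarrow> real) \<Rightarrow> real \<Rightarrow> nat \<Rightarrow> bool" where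
  "cone_distributed M X p n \<longleftrightarrow>
     X \<in> measurable M (lebesgue_n n) \<and>
     distr M (lebesgue_n n) X = distr (cone_measure p n) (lebesgue_n n) (\<lambda>x. x)"

end

theory Submission
  imports Defs
begin

text \<open>
  Put \<open>Y\<^sub>i = \<bar>x\<^sub>i\<bar> powr p\<close>, \<open>N = \<Sum>i. Y\<^sub>i\<close> and \<open>Q = \<Sum>i. Y\<^sub>i\<^sup>2\<close>. On the sphere \<open>N = 1\<close>, and the elementary symmetric
  sums satisfy \<open>1 - k\<^sup>2 Q \<le> k! e\<^sub>k(Y) \<le> 1\<close>; so if \<open>Q\<close> is small then both symmetric means are close to
  \<open>n powr (-1/p)\<close>, and it suffices that \<open>Q\<close> tends to 0 in probability. The cone over \<open>{Q \<ge> e}\<close> lies in the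
  dilation-invariant set \<open>{e N\<^sup>2 \<le> Q}\<close>. By the layer-cake formula the share of such a set in the
  volume of the ball equals its share of the integral of \<open>exp (- N)\<close>, under which the coordinates are
  independent: the common factor \<open>cone_factor p n\<close>, which is \<open>\<Gamma>(n/p + 1)\<close>, cancels and is never computed.
  Where \<open>N \<le> n a\<close>, a Chernoff bound gives a geometrically small share; elsewhere
  \<open>Q \<ge> e (n a)\<^sup>2\<close>, and Markov's inequality for \<open>Q\<close> gives \<open>O(1/n)\<close>.
\<close>

section \<open>Elementary symmetric sums\<close>

definition elem_sym :: "nat \<Rightarrow> 'a set \<Rightarrow> ('a \<Rightarrow> real) \<Rightarrow> real" where
  "elem_sym k F y = (\<Sum>I | I \<subseteq> F \<and> card I = k. \<Prod>i\<in>I. y i)"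

lemma elem_sym_0: "finite F \<Longrightarrow> elem_sym 0 F y = 1"
proof -
  assume "finite F"
  then have "{I. I \<subseteq> F \<and> card I = 0} = {{}}"
    by (auto dest: finite_subset)
  then show ?thesis
    unfolding elem_sym_def by simp
qed

lemma elem_sym_Suc_empty: "elem_sym (Suc k) {} y = 0"
  unfolding elem_sym_def by (rule sum.neutral) auto

text \<open>The two terms collect the subsets that avoid \<open>a\<close> and those that contain it.
  The inductions over \<open>F\<close> below run on this recursion.\<close>

lemma elem_sym_Suc_insert:
  assumes "finite F" "a \<notin> F"
  shows "elem_sym (Suc k) (insert a F) y = elem_sym (Suc k) F y + y a * elem_sym k F y"
proof -
  let ?A = "{I. I \<subseteq> F \<and> card I = Suc k}" and ?B = "{I. I \<subseteq> F \<and> card I = k}"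
  have fin: "finite I" if "I \<subseteq> F" for I
    using that assms(1) by (rule finite_subset)
  have inj: "inj_on (insert a) ?B"
    using assms(2) by (intro inj_onI) (blast dest: insert_ident[THEN iffD1, rotated 2])
  have "{I. I \<subseteq> insert a F \<and> card I = Suc k} = ?A \<union> insert a ` ?B"
  proof (intro equalityI subsetI)
    fix I assume I: "I \<in> {I. I \<subseteq> insert a F \<and> card I = Suc k}"
    show "I \<in> ?A \<union> insert a ` ?B"
    proof (cases "a \<in> I")
      case True
      then have "I = insert a (I - {a})" "I - {a} \<in> ?B"
        using I by auto
      then show ?thesis by blast
    qed (use I in auto)
  qed (use assms fin in \<open>auto simp: card_insert_if\<close>)
  moreover have "?A \<inter> insert a ` ?B = {}"
    using assms(2) by auto
  ultimately have "elem_sym (Suc k) (insert a F) y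
      = elem_sym (Suc k) F y + (\<Sum>I\<in>insert a ` ?B. \<Prod>i\<in>I. y i)"
    unfolding elem_sym_def using assms(1) by (simp add: sum.union_disjoint)
  also have "(\<Sum>I\<in>insert a ` ?B. \<Prod>i\<in>I. y i) = (\<Sum>I\<in>?B. y a * (\<Prod>i\<in>I. y i))"
    unfolding sum.reindex[OF inj] comp_def
    by (rule sum.cong) (use assms(2) fin in \<open>auto intro!: prod.insert\<close>)
  finally show ?thesis
    unfolding elem_sym_def by (simp add: sum_distrib_left)
qed

lemma elem_sym_nonneg: "(\<And>i. i \<in> F \<Longrightarrow> 0 \<le> y i) \<Longrightarrow> 0 \<le> elem_sym k F y"
  unfolding elem_sym_def by (intro sum_nonneg prod_nonneg) auto

lemma elem_sym_1: "finite F \<Longrightarrow> elem_sym (Suc 0) F y = sum y F"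
  by (induction F rule: finite_induct)
    (simp_all add: elem_sym_Suc_insert elem_sym_Suc_empty elem_sym_0)

text \<open>Expanding the product on the right yields every monomial of
  \<open>elem_sym (Suc k) F y\<close> exactly \<open>Suc k\<close> times, once for each choice of
  the factor taken from \<open>sum y F\<close>; the remaining terms contain a square and are
  nonnegative. The induction keeps \<open>k\<close> arbitrary because adding a point calls on two
  consecutive orders.\<close>

lemma elem_sym_Suc_le:
  assumes "finite F" "\<And>i. i \<in> F \<Longrightarrow> 0 \<le> y i"
  shows "real (Suc k) * elem_sym (Suc k) F y \<le> sum y F * elem_sym k F y"
  using assms
proof (induction F arbitrary: k rule: finite_induct)
  case empty
  then show ?case by (simp add: elem_sym_Suc_empty)
next
  case (insert a F)
  have y: "0 \<le> y a" and e: "\<And>k. 0 \<le> elem_sym k F y"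
    using insert.prems by (auto intro: elem_sym_nonneg)
  have IH: "real (Suc k) * elem_sym (Suc k) F y \<le> sum y F * elem_sym k F y" for k
    using insert by auto
  show ?case
  proof (cases k)
    case 0
    then show ?thesis
      using insert.hyps by (simp add: elem_sym_1 elem_sym_0)
  next
    case (Suc j)
    \<comment> \<open>The hypothesis at order \<open>Suc j\<close>, plus \<open>y a\<close> times
      the one at order \<open>j\<close>, gives the claim with slack
      \<open>(y a)^2 * elem_sym j F y\<close>.\<close>
    have "y a * (real (Suc j) * elem_sym (Suc j) F y) \<le> y a * (sum y F * elem_sym j F y)"
      by (intro mult_left_mono IH y)
    moreover have "0 \<le> y a * (y a * elem_sym j F y)"
      using y e by simp
    ultimately show ?thesis
      using IH[of "Suc j"] insert.hyps
      by (simp add: Suc elem_sym_Suc_insert algebra_simps)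
  qed
qed

text \<open>In the expansion of the product on the left, the terms with a square add up to the sum
  over \<open>i\<close> of \<open>(y i)^2\<close> times the symmetric sum of order \<open>k\<close>
  over \<open>F - {i}\<close>. Enlarging \<open>F - {i}\<close> to \<open>F\<close> bounds
  them.\<close>

lemma elem_sym_Suc_ge:
  assumes "finite F" "\<And>i. i \<in> F \<Longrightarrow> 0 \<le> y i"
  shows "sum y F * elem_sym (Suc k) F y
    \<le> real (Suc (Suc k)) * elem_sym (Suc (Suc k)) F y + (\<Sum>i\<in>F. (y i)\<^sup>2) * elem_sym k F y"
  using assms
proof (induction F arbitrary: k rule: finite_induct)
  case empty
  then show ?case by (simp add: elem_sym_Suc_empty)
next
  case (insert a F)
  have y: "0 \<le> y a" and e: "\<And>k. 0 \<le> elem_sym k F y"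
    using insert.prems by (auto intro: elem_sym_nonneg)
  define q where "q = (\<Sum>i\<in>F. (y i)\<^sup>2)"
  have q: "0 \<le> q"
    unfolding q_def by (simp add: sum_nonneg)
  have IH: "sum y F * elem_sym (Suc k) F y
    \<le> real (Suc (Suc k)) * elem_sym (Suc (Suc k)) F y + q * elem_sym k F y" for k
    using insert unfolding q_def by auto
  have ins: "sum y (insert a F) = y a + sum y F" "(\<Sum>i\<in>insert a F. (y i)\<^sup>2) = y a * y a + q"
    using insert.hyps by (auto simp: q_def power2_eq_square)
  show ?case
  proof (cases k)
    case 0
    then show ?thesis
      unfolding ins using insert.hyps IH[of 0]
      by (simp add: elem_sym_Suc_insert elem_sym_1 elem_sym_0 algebra_simps)
  next
    case (Suc j)
    have "y a * (sum y F * elem_sym (Suc j) F y)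
        \<le> y a * (real (Suc (Suc j)) * elem_sym (Suc (Suc j)) F y + q * elem_sym j F y)"
      by (intro mult_left_mono IH y)
    moreover have "0 \<le> y a * (y a * (y a * elem_sym j F y))"
      using y e by simp
    ultimately show ?thesis
      unfolding ins using IH[of "Suc j"] insert.hyps
      by (simp add: Suc elem_sym_Suc_insert algebra_simps)
  qed
qed

lemma fact_elem_sym_le_1:
  assumes "finite F" "\<And>i. i \<in> F \<Longrightarrow> 0 \<le> y i" "sum y F = 1"
  shows "fact k * elem_sym k F y \<le> 1"
proof (induction k)
  case (Suc k)
  have "fact k * (real (Suc k) * elem_sym (Suc k) F y) \<le> fact k * elem_sym k F y"
    using elem_sym_Suc_le[of F y k, OF assms(1,2)] assms(3) by (intro mult_left_mono) auto
  with Suc show ?case by (simp add: algebra_simps)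
qed (use assms in \<open>simp add: elem_sym_0\<close>)

text \<open>By \<open>elem_sym_Suc_ge\<close>, passing from order \<open>k + 1\<close> to
  \<open>k + 2\<close> loses at most \<open>(k + 1) * q\<close>, because
  \<open>fact k * elem_sym k F y\<close> is at most 1. The losses up to order \<open>k\<close> sum
  to at most \<open>(k choose 2) * q\<close>; the factor \<open>k^2\<close> is a rounder
  bound.\<close>

lemma fact_elem_sym_ge:
  assumes "finite F" "\<And>i. i \<in> F \<Longrightarrow> 0 \<le> y i" "sum y F = 1"
  shows "1 - (real k)\<^sup>2 * (\<Sum>i\<in>F. (y i)\<^sup>2) \<le> fact k * elem_sym k F y"
proof -
  define q where "q = (\<Sum>i\<in>F. (y i)\<^sup>2)"
  have q: "0 \<le> q"
    unfolding q_def by (simp add: sum_nonneg)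
  \<comment> \<open>The induction starts at order 1, where the value is \<open>sum y F = 1\<close>,
    since \<open>elem_sym_Suc_ge\<close> links two consecutive positive orders.\<close>
  have step: "1 - (real (Suc k))\<^sup>2 * q \<le> fact (Suc k) * elem_sym (Suc k) F y" for k
  proof (induction k)
    case 0
    then show ?case using assms q by (simp add: elem_sym_1)
  next
    case (Suc k)
    have "fact (Suc k) * elem_sym (Suc k) F y
        \<le> fact (Suc k) * (real (Suc (Suc k)) * elem_sym (Suc (Suc k)) F y + q * elem_sym k F y)"
      using elem_sym_Suc_ge[of F y k, OF assms(1,2)] assms(3)
      by (intro mult_left_mono) (auto simp: q_def)
    also have "\<dots> = fact (Suc (Suc k)) * elem_sym (Suc (Suc k)) F y
        + real (Suc k) * q * (fact k * elem_sym k F y)"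
      by (simp add: algebra_simps)
    also have "real (Suc k) * q * (fact k * elem_sym k F y) \<le> real (Suc k) * q * 1"
      using fact_elem_sym_le_1[OF assms] q by (intro mult_left_mono) auto
    finally have "fact (Suc k) * elem_sym (Suc k) F y
      \<le> fact (Suc (Suc k)) * elem_sym (Suc (Suc k)) F y + real (Suc k) * q"
      by simp
    moreover have "(real (Suc k))\<^sup>2 * q + real (Suc k) * q \<le> (real (Suc (Suc k)))\<^sup>2 * q"
      using q unfolding distrib_right[symmetric]
      by (intro mult_right_mono) (auto simp: power2_eq_square algebra_simps)
    ultimately show ?case using Suc by linarith
  qed
  show ?thesis
  proof (cases k)
    case 0
    then show ?thesis using assms by (simp add: elem_sym_0)
  next
    case (Suc j)
    then show ?thesis using step[of j] by (simp add: q_def)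
  qed
qed

section \<open>Volumes of cones\<close>

definition power_sum :: "real \<Rightarrow> nat \<Rightarrow> (nat \<Rightarrow> real) \<Rightarrow> real" where
  "power_sum p n x = (\<Sum>i=1..n. \<bar>x i\<bar> powr p)"

text \<open>Restricting to \<open>{1..n}\<close> keeps the result extensional, hence in
  \<open>space (lebesgue_n n)\<close>, and matches the scaling inside
  \<open>cone_over\<close>.\<close>

definition dilate :: "nat \<Rightarrow> real \<Rightarrow> (nat \<Rightarrow> real) \<Rightarrow> nat \<Rightarrow> real" where
  "dilate n r x = (\<lambda>i\<in>{1..n}. r * x i)"

lemma product_sigma_finite_lborel: "product_sigma_finite (\<lambda>_::nat. lborel :: real measure)"
  by (simp add: product_sigma_finite_def sigma_finite_lborel)

lemma sigma_finite_lebesgue_n: "sigma_finite_measure (lebesgue_n n)"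
  unfolding lebesgue_n_def
  by (rule product_sigma_finite.sigma_finite[OF product_sigma_finite_lborel]) simp

lemma power_sum_nonneg [simp]: "0 \<le> power_sum p n x"
  unfolding power_sum_def by (intro sum_nonneg) simp

lemma power_sum_measurable [measurable]: "power_sum p n \<in> borel_measurable (lebesgue_n n)"
  unfolding power_sum_def[abs_def] lebesgue_n_def by measurable

lemma power_sum_dilate: "0 < r \<Longrightarrow> power_sum p n (dilate n r x) = r powr p * power_sum p n x"
  unfolding power_sum_def dilate_def sum_distrib_left
  by (intro sum.cong) (auto simp: abs_mult powr_mult)

lemma dilate_measurable [measurable]: "dilate n r \<in> measurable (lebesgue_n n) (lebesgue_n n)"
  unfolding dilate_def[abs_def] lebesgue_n_def by measurable

lemma emeasure_lborel_dilate:
  assumes "0 < (r::real)" "A \<in> sets borel"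
  shows "emeasure lborel A = ennreal r * emeasure lborel {x. r * x \<in> A}"
proof -
  have [measurable]: "A \<in> sets borel" by fact
  have "emeasure lborel A = (\<integral>\<^sup>+x. indicator A x \<partial>lborel)"
    by simp
  also have "\<dots> = ennreal r * (\<integral>\<^sup>+x. indicator A (0 + r * x) \<partial>lborel)"
    using assms(1) by (subst nn_integral_real_affine[where t = 0 and c = r]) auto
  also have "(\<integral>\<^sup>+x. indicator A (0 + r * x) \<partial>lborel)
      = (\<integral>\<^sup>+x. indicator {x. r * x \<in> A} x \<partial>lborel)"
    by (intro nn_integral_cong) (simp add: indicator_def)
  also have "\<dots> = emeasure lborel {x. r * x \<in> A}"
    by (intro nn_integral_indicator) measurable
  finally show ?thesis .
qed

text \<open>The rescaled image measure agrees with the product measure on boxes, by one-dimensional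
  scaling in each coordinate, so uniqueness of the product measure applies.\<close>

lemma emeasure_lebesgue_n_dilate:
  assumes r: "0 < r" and B: "B \<in> sets (lebesgue_n n)"
  shows "emeasure (lebesgue_n n) B
    = ennreal (r ^ n) * emeasure (lebesgue_n n) (dilate n r -` B \<inter> space (lebesgue_n n))"
proof -
  let ?L = "lebesgue_n n"
  let ?D = "scale_measure (ennreal (r ^ n)) (distr ?L ?L (dilate n r))"
  interpret product_sigma_finite "\<lambda>_::nat. lborel :: real measure"
    by (rule product_sigma_finite_lborel)
  have "?D = PiM {1..n} (\<lambda>_. lborel)"
  proof (rule PiM_eqI)
    fix A :: "nat \<Rightarrow> real set" assume A: "\<And>i. i \<in> {1..n} \<Longrightarrow> A i \<in> sets lborel"
    have box: "Pi\<^sub>E {1..n} A \<in> sets ?L"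
      unfolding lebesgue_n_def using A by (intro sets_PiM_I_finite) auto
    have pre: "{x. r * x \<in> A i} \<in> sets lborel" if "i \<in> {1..n}" for i
    proof -
      have [measurable]: "A i \<in> sets borel" using A[OF that] by simp
      show ?thesis by measurable
    qed
    have "dilate n r -` Pi\<^sub>E {1..n} A \<inter> space ?L = Pi\<^sub>E {1..n} (\<lambda>i. {x. r * x \<in> A i})"
      by (auto simp: lebesgue_n_def space_PiM dilate_def PiE_iff extensional_def)
    then have "emeasure ?D (Pi\<^sub>E {1..n} A)
        = ennreal (r ^ n) * emeasure ?L (Pi\<^sub>E {1..n} (\<lambda>i. {x. r * x \<in> A i}))"
      using box by (simp add: emeasure_distr)
    also have "\<dots> = ennreal (r ^ n) * (\<Prod>i\<in>{1..n}. emeasure lborel {x. r * x \<in> A i})"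
      unfolding lebesgue_n_def using pre by (subst emeasure_PiM) auto
    also have "\<dots> = (\<Prod>i\<in>{1..n}. ennreal r * emeasure lborel {x. r * x \<in> A i})"
      using r by (simp add: prod.distrib ennreal_power)
    also have "\<dots> = (\<Prod>i\<in>{1..n}. emeasure lborel (A i))"
      using r A by (intro prod.cong refl emeasure_lborel_dilate[symmetric]) auto
    finally show "emeasure ?D (Pi\<^sub>E {1..n} A) = (\<Prod>i\<in>{1..n}. emeasure lborel (A i))" .
  qed (simp_all add: lebesgue_n_def)
  then have "emeasure ?L B = emeasure ?D B"
    by (simp add: lebesgue_n_def)
  also have "\<dots> = ennreal (r ^ n) * emeasure ?L (dilate n r -` B \<inter> space ?L)"
    using B by (simp add: emeasure_distr)
  finally show ?thesis .
qed

section \<open>Layer-cake formula for dilation-invariant sets\<close>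

lemma nn_integral_exp_minus_atLeast:
  "(\<integral>\<^sup>+t. ennreal (exp (- t)) * indicator {a..} t \<partial>lborel) = ennreal (exp (- a))" for a :: real
proof -
  have "((\<lambda>x::real. - exp (- x)) \<longlongrightarrow> - 0) at_top"
    by (intro tendsto_minus filterlim_compose[OF exp_at_bot] filterlim_uminus_at_bot_at_top)
  then have "(\<integral>\<^sup>+t. ennreal (exp (- t)) * indicator {a..} t \<partial>lborel) = ennreal (- 0 - (- exp (- a)))"
    by (intro nn_integral_FTC_atLeast) (auto intro!: derivative_eq_intros)
  then show ?thesis by simp
qed

definition cone_factor :: "real \<Rightarrow> nat \<Rightarrow> ennreal" where
  "cone_factor p n
    = (\<integral>\<^sup>+t. ennreal (exp (- t)) * (ennreal ((t powr (1 / p)) ^ n) * indicator {0..} t) \<partial>lborel)"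

lemma p_ball_eq:
  assumes "0 < p"
  shows "p_ball p n = {x \<in> space (lebesgue_n n). power_sum p n x \<le> 1}"
proof -
  have "s powr (1 / p) \<le> 1 \<longleftrightarrow> s \<le> 1" if "0 \<le> s" for s :: real
  proof (cases "1 < s")
    case True
    then have "1 < s powr (1 / p)"
      using assms powr_less_mono2[of "1 / p" 1 s] by simp
    with True show ?thesis by simp
  qed (use that assms powr_le1[of "1 / p" s] in auto)
  then show ?thesis
    unfolding p_ball_def p_norm_def power_sum_def by (auto simp: sum_nonneg)
qed

text \<open>Write \<open>exp (- N)\<close> as the integral of \<open>exp (- t)\<close> over t \<ge>
  N and swap the integrals. By invariance, the part of \<open>A\<close> with N \<le> t is the
  dilation of \<open>A Int p_ball p n\<close> by \<open>t powr (1 / p)\<close>, so \<open>A\<close>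
  enters the result only through its volume in the ball.\<close>

lemma nn_integral_exp_cone:
  assumes p: "0 < p" and A: "A \<in> sets (lebesgue_n n)"
    and cone: "\<And>r x. 0 < r \<Longrightarrow> x \<in> space (lebesgue_n n) \<Longrightarrow> dilate n r x \<in> A \<longleftrightarrow> x \<in> A"
  shows "(\<integral>\<^sup>+x. indicator A x * ennreal (exp (- power_sum p n x)) \<partial>lebesgue_n n)
    = cone_factor p n * emeasure (lebesgue_n n) (A \<inter> p_ball p n)"
proof -
  let ?L = "lebesgue_n n"
  let ?f = "\<lambda>x t. ennreal (exp (- t)) * indicator {(x, t). x \<in> A \<and> power_sum p n x \<le> t} (x, t)"
  interpret L: sigma_finite_measure ?L by (rule sigma_finite_lebesgue_n)
  interpret P: pair_sigma_finite ?L "lborel :: real measure" ..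
  have [measurable]: "A \<in> sets ?L" by fact
  have level_sets [measurable]: "{x \<in> A. power_sum p n x \<le> t} \<in> sets ?L" for t
  proof -
    have "{x \<in> A. power_sum p n x \<le> t} = A \<inter> {x \<in> space ?L. power_sum p n x \<le> t}"
      using sets.sets_into_space[OF A] by auto
    then show ?thesis by simp
  qed
  have level: "emeasure ?L {x \<in> A. power_sum p n x \<le> t}
      = ennreal ((t powr (1 / p)) ^ n) * emeasure ?L (A \<inter> p_ball p n)" if t: "0 < t" for t
  proof -
    let ?r = "t powr (1 / p)"
    have r: "0 < ?r" using t by simp
    have "dilate n ?r -` {x \<in> A. power_sum p n x \<le> t} \<inter> space ?L = A \<inter> p_ball p n"
      unfolding p_ball_eq[OF p]
      using t p r cone sets.sets_into_space[OF A]
      by (auto simp: power_sum_dilate powr_powr)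
    then show ?thesis
      using emeasure_lebesgue_n_dilate[OF r level_sets] by simp
  qed
  have "(\<integral>\<^sup>+x. indicator A x * ennreal (exp (- power_sum p n x)) \<partial>?L)
      = (\<integral>\<^sup>+x. (\<integral>\<^sup>+t. ?f x t \<partial>lborel) \<partial>?L)"
  proof (rule nn_integral_cong)
    fix x
    have "(\<integral>\<^sup>+t. ?f x t \<partial>lborel)
        = (\<integral>\<^sup>+t. indicator A x * (ennreal (exp (- t)) * indicator {power_sum p n x..} t) \<partial>lborel)"
      by (intro nn_integral_cong) (simp add: indicator_def)
    then show "indicator A x * ennreal (exp (- power_sum p n x)) = (\<integral>\<^sup>+t. ?f x t \<partial>lborel)"
      by (simp add: nn_integral_cmult nn_integral_exp_minus_atLeast)
  qed
  also have "\<dots> = (\<integral>\<^sup>+t. (\<integral>\<^sup>+x. ?f x t \<partial>?L) \<partial>lborel)"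
    by (rule P.Fubini'[symmetric]) measurable
  also have "\<dots> = (\<integral>\<^sup>+t. (ennreal (exp (- t)) * (ennreal ((t powr (1 / p)) ^ n) * indicator {0..} t))
      * emeasure ?L (A \<inter> p_ball p n) \<partial>lborel)"
  proof (rule nn_integral_cong_AE)
    \<comment> \<open>For t > 0 the fact \<open>level\<close> applies, for t < 0 the sublevel set is
      empty and the indicator vanishes, and the point t = 0 is a null set.\<close>
    have "AE t in lborel. t \<noteq> (0::real)"
      by (rule AE_lborel_singleton)
    then show "AE t in lborel. (\<integral>\<^sup>+x. ?f x t \<partial>?L)
      = (ennreal (exp (- t)) * (ennreal ((t powr (1 / p)) ^ n) * indicator {0..} t))
      * emeasure ?L (A \<inter> p_ball p n)"
    proof eventually_elim
      case (elim t)
      have "(\<integral>\<^sup>+x. ?f x t \<partial>?L)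
          = (\<integral>\<^sup>+x. ennreal (exp (- t)) * indicator {x \<in> A. power_sum p n x \<le> t} x \<partial>?L)"
        by (intro nn_integral_cong) (simp add: indicator_def)
      also have "\<dots> = ennreal (exp (- t)) * emeasure ?L {x \<in> A. power_sum p n x \<le> t}"
        by (simp add: nn_integral_cmult_indicator)
      also have "\<dots> = (ennreal (exp (- t)) * (ennreal ((t powr (1 / p)) ^ n) * indicator {0..} t))
          * emeasure ?L (A \<inter> p_ball p n)"
      proof (cases "0 < t")
        case True
        then show ?thesis by (simp add: level mult.assoc)
      next
        case False
        then have "t < 0" using elim by simp
        then have empty: "{x \<in> A. power_sum p n x \<le> t} = {}"
          using power_sum_nonneg[of p n] by (auto simp: not_le intro: less_le_trans)
        show ?thesis
          unfolding empty using \<open>t < 0\<close> by simp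
      qed
      finally show ?case .
    qed
  qed
  also have "\<dots> = cone_factor p n * emeasure ?L (A \<inter> p_ball p n)"
    unfolding cone_factor_def by (rule nn_integral_multc) measurable
  finally show ?thesis .
qed

section \<open>Concentration of the power sums\<close>

definition exp_integral :: "real \<Rightarrow> real \<Rightarrow> ennreal" where
  "exp_integral p s = (\<integral>\<^sup>+x. ennreal (exp (- (s * \<bar>x\<bar> powr p))) \<partial>lborel)"

text \<open>Substitution by the factor \<open>s powr (1 / p)\<close>. The case \<open>s = 2\<close>
  gives the gain in the Chernoff bound, the case \<open>s = 1 / 2\<close> the finiteness of the
  second moment.\<close>

lemma exp_integral_scale:
  assumes "0 < p" "0 < s"
  shows "exp_integral p 1 = ennreal (s powr (1 / p)) * exp_integral p s"
proof -
  let ?c = "s powr (1 / p)"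
  have "exp_integral p 1 = ennreal \<bar>?c\<bar> * (\<integral>\<^sup>+x. ennreal (exp (- (1 * \<bar>0 + ?c * x\<bar> powr p))) \<partial>lborel)"
    unfolding exp_integral_def using assms by (intro nn_integral_real_affine) auto
  also have "(\<lambda>x. exp (- (1 * \<bar>0 + ?c * x\<bar> powr p))) = (\<lambda>x. exp (- (s * \<bar>x\<bar> powr p)))"
    using assms by (auto simp: abs_mult powr_mult powr_powr)
  finally show ?thesis unfolding exp_integral_def by simp
qed

lemma exp_integral_finite:
  assumes "1 \<le> p"
  shows "exp_integral p 1 < \<infinity>"
proof -
  define h where "h x = ennreal (exp (- x)) * indicator {0..} x" for x :: real
  have [measurable]: "h \<in> borel_measurable borel"
    unfolding h_def[abs_def] by measurable
  have h: "(\<integral>\<^sup>+x. h x \<partial>lborel) = 1"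
    by (simp add: h_def nn_integral_exp_minus_atLeast)
  have h': "(\<integral>\<^sup>+x. h (- x) \<partial>lborel) = 1"
    using nn_integral_real_affine[of h "-1" 0] h by simp
  have "exp_integral p 1 \<le> (\<integral>\<^sup>+x. ennreal (exp 1) * (h x + h (- x)) \<partial>lborel)"
    unfolding exp_integral_def
  proof (rule nn_integral_mono)
    fix x :: real
    \<comment> \<open>Here \<open>1 \<le> p\<close> enters: the integrand is dominated by a multiple
      of the two-sided exponential, whose halves are \<open>h x\<close> and
      \<open>h (- x)\<close>.\<close>
    have "\<bar>x\<bar> - 1 \<le> \<bar>x\<bar> powr p"
    proof (cases "1 \<le> \<bar>x\<bar>")
      case True
      then show ?thesis using powr_mono[of 1 p "\<bar>x\<bar>"] assms by simp
    next
      case False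
      then have "\<bar>x\<bar> - 1 \<le> 0" by simp
      also have "0 \<le> \<bar>x\<bar> powr p" by simp
      finally show ?thesis .
    qed
    then have "ennreal (exp (- (1 * \<bar>x\<bar> powr p))) \<le> ennreal (exp 1 * exp (- \<bar>x\<bar>))"
      unfolding exp_add[symmetric] by (intro ennreal_leI) simp
    also have "\<dots> = ennreal (exp 1) * ennreal (exp (- \<bar>x\<bar>))"
      by (simp add: ennreal_mult)
    also have "\<dots> \<le> ennreal (exp 1) * (h x + h (- x))"
      by (intro mult_left_mono) (auto simp: h_def indicator_def abs_if)
    finally show "ennreal (exp (- (1 * \<bar>x\<bar> powr p))) \<le> ennreal (exp 1) * (h x + h (- x))" .
  qed
  also have "\<dots> = ennreal (exp 1) * (1 + 1)"
    by (simp add: nn_integral_cmult nn_integral_add h h')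
  also have "\<dots> < \<infinity>"
    by (simp add: ennreal_mult_less_top)
  finally show ?thesis .
qed

lemma exp_integral_pos:
  assumes "0 < p"
  shows "0 < exp_integral p 1"
proof -
  have "ennreal (exp (-1)) = (\<integral>\<^sup>+x. ennreal (exp (-1)) * indicator {0..1::real} x \<partial>lborel)"
    by (subst nn_integral_cmult_indicator) auto
  also have "\<dots> \<le> exp_integral p 1"
    unfolding exp_integral_def
    using assms by (intro nn_integral_mono) (auto simp: indicator_def powr_le1 intro!: ennreal_leI)
  finally show ?thesis
    by (rule less_le_trans[rotated]) simp
qed

lemma second_moment_finite:
  assumes "1 \<le> p"
  shows "(\<integral>\<^sup>+x. ennreal (\<bar>x\<bar> powr (2 * p) * exp (- (\<bar>x\<bar> powr p))) \<partial>lborel) < \<infinity>"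
proof -
  have "(\<integral>\<^sup>+x. ennreal (\<bar>x\<bar> powr (2 * p) * exp (- (\<bar>x\<bar> powr p))) \<partial>lborel)
      \<le> (\<integral>\<^sup>+x. ennreal 8 * ennreal (exp (- (1 / 2 * \<bar>x\<bar> powr p))) \<partial>lborel)"
  proof (rule nn_integral_mono)
    fix x :: real
    define y where "y = \<bar>x\<bar> powr p"
    \<comment> \<open>The quadratic term equals \<open>y^2 / 8\<close>, whence the constant 8. Half
      of the exponent absorbs \<open>y^2\<close>, and the other half remains integrable.\<close>
    have "1 + y / 2 + (y / 2)\<^sup>2 / 2 \<le> exp (y / 2)"
      by (rule exp_lower_Taylor_quadratic) (simp add: y_def)
    moreover have "0 \<le> y" by (simp add: y_def)
    ultimately have "y\<^sup>2 \<le> 8 * exp (y / 2)"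
      by (simp add: power2_eq_square)
    then have "y\<^sup>2 * exp (- y) \<le> 8 * exp (y / 2) * exp (- y)"
      by (intro mult_right_mono) auto
    also have "\<dots> = 8 * exp (- (1 / 2 * y))"
      by (simp add: mult.assoc flip: exp_add)
    also have "y\<^sup>2 = \<bar>x\<bar> powr (2 * p)"
      unfolding y_def by (cases "x = 0") (auto simp: power2_eq_square simp flip: powr_add)
    finally have "ennreal (\<bar>x\<bar> powr (2 * p) * exp (- y)) \<le> ennreal (8 * exp (- (1 / 2 * y)))"
      by (rule ennreal_leI)
    also have "\<dots> = ennreal 8 * ennreal (exp (- (1 / 2 * y)))"
      by (rule ennreal_mult) auto
    finally show "ennreal (\<bar>x\<bar> powr (2 * p) * exp (- (\<bar>x\<bar> powr p)))
        \<le> ennreal 8 * ennreal (exp (- (1 / 2 * \<bar>x\<bar> powr p)))"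
      unfolding y_def .
  qed
  also have "\<dots> = ennreal 8 * exp_integral p (1 / 2)"
    unfolding exp_integral_def by (rule nn_integral_cmult) measurable
  also have "\<dots> < \<infinity>"
  proof -
    have "ennreal ((1 / 2) powr (1 / p)) * exp_integral p (1 / 2) < \<infinity>"
      using exp_integral_scale[of p "1 / 2"] exp_integral_finite[OF assms] assms by simp
    then show ?thesis by (auto simp: ennreal_mult_less_top)
  qed
  finally show ?thesis .
qed

lemma nn_integral_exp_power_sum:
  assumes "0 \<le> s"
  shows "(\<integral>\<^sup>+x. ennreal (exp (- (s * power_sum p n x))) \<partial>lebesgue_n n) = exp_integral p s ^ n"
proof -
  interpret product_sigma_finite "\<lambda>_::nat. lborel :: real measure"
    by (rule product_sigma_finite_lborel)
  have "ennreal (exp (- (s * power_sum p n x))) = (\<Prod>i=1..n. ennreal (exp (- (s * \<bar>x i\<bar> powr p))))"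
    for x
    unfolding power_sum_def
    by (simp add: prod_ennreal exp_sum sum_distrib_left flip: sum_negf)
  then have "(\<integral>\<^sup>+x. ennreal (exp (- (s * power_sum p n x))) \<partial>lebesgue_n n)
      = (\<integral>\<^sup>+x. (\<Prod>i=1..n. ennreal (exp (- (s * \<bar>x i\<bar> powr p)))) \<partial>PiM {1..n} (\<lambda>_. lborel))"
    unfolding lebesgue_n_def by simp
  also have "\<dots> = (\<Prod>i=1..n. exp_integral p s)"
    unfolding exp_integral_def by (rule product_nn_integral_prod) auto
  finally show ?thesis by simp
qed

text \<open>By linearity each summand is treated alone. The \<open>i\<close>-th one factors over the
  coordinates, with the second moment at \<open>i\<close> and the plain weight at the other
  \<open>n - 1\<close>; \<open>g i j\<close> is its factor at coordinate \<open>j\<close>.\<close>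

lemma nn_integral_power_sum_exp:
  "(\<integral>\<^sup>+x. ennreal (power_sum (2 * p) n x * exp (- power_sum p n x)) \<partial>lebesgue_n n)
    = of_nat n * (\<integral>\<^sup>+x. ennreal (\<bar>x\<bar> powr (2 * p) * exp (- (\<bar>x\<bar> powr p))) \<partial>lborel)
        * exp_integral p 1 ^ (n - 1)"
proof -
  interpret product_sigma_finite "\<lambda>_::nat. lborel :: real measure"
    by (rule product_sigma_finite_lborel)
  define m where "m = (\<integral>\<^sup>+x. ennreal (\<bar>x\<bar> powr (2 * p) * exp (- (\<bar>x\<bar> powr p))) \<partial>lborel)"
  define g where "g i j y = (if j = i then ennreal (\<bar>y\<bar> powr (2 * p) * exp (- (\<bar>y\<bar> powr p)))
      else ennreal (exp (- (\<bar>y\<bar> powr p))))" for i j :: nat and y :: real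
  have gm [measurable]: "g i j \<in> borel_measurable borel" for i j
    unfolding g_def[abs_def] by measurable
  have fac: "ennreal (\<bar>x i\<bar> powr (2 * p) * exp (- power_sum p n x)) = (\<Prod>j=1..n. g i j (x j))"
    if "i \<in> {1..n}" for i x
  proof -
    have "exp (- power_sum p n x) = (\<Prod>j=1..n. exp (- (\<bar>x j\<bar> powr p)))"
      unfolding power_sum_def by (simp add: exp_sum flip: sum_negf)
    also have "\<dots> = exp (- (\<bar>x i\<bar> powr p)) * (\<Prod>j\<in>{1..n} - {i}. exp (- (\<bar>x j\<bar> powr p)))"
      using that by (simp add: prod.remove)
    finally have "ennreal (\<bar>x i\<bar> powr (2 * p) * exp (- power_sum p n x))
      = g i i (x i) * (\<Prod>j\<in>{1..n} - {i}. ennreal (exp (- (\<bar>x j\<bar> powr p))))"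
      by (simp add: g_def prod_ennreal prod_nonneg ennreal_mult[symmetric] mult.assoc)
    also have "\<dots> = g i i (x i) * (\<Prod>j\<in>{1..n} - {i}. g i j (x j))"
      by (intro arg_cong2[where f = "(*)"] refl prod.cong) (auto simp: g_def)
    finally show ?thesis
      using that by (simp add: prod.remove)
  qed
  have int: "(\<integral>\<^sup>+x. (\<Prod>j=1..n. g i j (x j)) \<partial>lebesgue_n n) = m * exp_integral p 1 ^ (n - 1)"
    if i: "i \<in> {1..n}" for i
  proof -
    have "(\<integral>\<^sup>+x. (\<Prod>j=1..n. g i j (x j)) \<partial>lebesgue_n n) = (\<Prod>j=1..n. integral\<^sup>N lborel (g i j))"
      unfolding lebesgue_n_def by (rule product_nn_integral_prod) auto
    also have "\<dots> = integral\<^sup>N lborel (g i i) * (\<Prod>j\<in>{1..n} - {i}. integral\<^sup>N lborel (g i j))"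
      using i by (simp add: prod.remove)
    also have "(\<Prod>j\<in>{1..n} - {i}. integral\<^sup>N lborel (g i j)) = (\<Prod>j\<in>{1..n} - {i}. exp_integral p 1)"
      by (intro prod.cong) (auto simp: g_def[abs_def] exp_integral_def)
    also have "integral\<^sup>N lborel (g i i) = m"
      by (simp add: g_def[abs_def] m_def)
    finally show ?thesis using i by simp
  qed
  have "(\<integral>\<^sup>+x. ennreal (power_sum (2 * p) n x * exp (- power_sum p n x)) \<partial>lebesgue_n n)
      = (\<integral>\<^sup>+x. (\<Sum>i=1..n. (\<Prod>j=1..n. g i j (x j))) \<partial>lebesgue_n n)"
    by (intro nn_integral_cong)
      (simp add: power_sum_def[of "2 * p"] sum_distrib_right sum_ennreal[symmetric] fac)
  also have "\<dots> = (\<Sum>i=1..n. (\<integral>\<^sup>+x. (\<Prod>j=1..n. g i j (x j)) \<partial>lebesgue_n n))"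
    by (rule nn_integral_sum) (simp add: lebesgue_n_def, measurable)
  also have "\<dots> = (\<Sum>i=1..n. m * exp_integral p 1 ^ (n - 1))"
    by (intro sum.cong refl int)
  finally show ?thesis by (simp add: m_def mult.assoc)
qed

section \<open>Volume share of the set where one coordinate is large\<close>

text \<open>Both sides scale by \<open>r powr (2 * p)\<close> under dilation, and on the sphere the
  condition reads Q \<ge> e. As Q is at most N times the largest summand, membership with N > 0
  forces one coordinate to carry at least the share \<open>e\<close> of N.\<close>

definition spiky :: "real \<Rightarrow> real \<Rightarrow> nat \<Rightarrow> (nat \<Rightarrow> real) set" where
  "spiky p e n = {x \<in> space (lebesgue_n n). e * (power_sum p n x)\<^sup>2 \<le> power_sum (2 * p) n x}"

lemma spiky_sets [measurable]: "spiky p e n \<in> sets (lebesgue_n n)"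
  unfolding spiky_def by measurable

lemma dilate_in_space: "dilate n r x \<in> space (lebesgue_n n)"
  unfolding dilate_def lebesgue_n_def by (simp add: space_PiM)

lemma dilate_spiky_iff:
  assumes "0 < r" "x \<in> space (lebesgue_n n)"
  shows "dilate n r x \<in> spiky p e n \<longleftrightarrow> x \<in> spiky p e n"
proof -
  have "r powr (2 * p) = (r powr p)\<^sup>2"
    using assms by (simp add: power2_eq_square flip: powr_add)
  then show ?thesis
    using assms by (simp add: spiky_def dilate_in_space power_sum_dilate power_mult_distrib)
qed

text \<open>The integrand is dominated pointwise. If N \<le> n a, then \<open>exp (- N)\<close> is
  at most \<open>exp (n * a) * exp (- (2 * N))\<close>; otherwise membership gives 1 \<le> Q / (e (n
  a)^2). The sum of the two bounds serves both cases and integrates coordinatewise.\<close>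

lemma nn_integral_exp_spiky_le:
  assumes "0 < e" "0 < a" "1 \<le> n"
  shows "(\<integral>\<^sup>+x. indicator (spiky p e n) x * ennreal (exp (- power_sum p n x)) \<partial>lebesgue_n n)
    \<le> ennreal (exp (real n * a)) * exp_integral p 2 ^ n
      + ennreal (1 / (e * (real n * a)\<^sup>2)) * (of_nat n
        * (\<integral>\<^sup>+x. ennreal (\<bar>x\<bar> powr (2 * p) * exp (- (\<bar>x\<bar> powr p))) \<partial>lborel)
        * exp_integral p 1 ^ (n - 1))"
proof -
  define b where "b = real n * a"
  have b: "0 < b" using assms by (simp add: b_def)
  have "(\<integral>\<^sup>+x. indicator (spiky p e n) x * ennreal (exp (- power_sum p n x)) \<partial>lebesgue_n n)
    \<le> (\<integral>\<^sup>+x. ennreal (exp b) * ennreal (exp (- (2 * power_sum p n x)))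
      + ennreal (1 / (e * b\<^sup>2)) * ennreal (power_sum (2 * p) n x * exp (- power_sum p n x))
      \<partial>lebesgue_n n)"
  proof (rule nn_integral_mono)
    fix x
    let ?N = "power_sum p n x" and ?Q = "power_sum (2 * p) n x"
    have "exp (- ?N) \<le> exp b * exp (- (2 * ?N)) + 1 / (e * b\<^sup>2) * (?Q * exp (- ?N))"
      if x: "x \<in> spiky p e n"
    proof (cases "?N \<le> b")
      case True
      then have "exp (- ?N) \<le> exp b * exp (- (2 * ?N))"
        by (simp flip: exp_add)
      moreover have "0 \<le> 1 / (e * b\<^sup>2) * (?Q * exp (- ?N))"
        using assms by (intro mult_nonneg_nonneg) auto
      ultimately show ?thesis by linarith
    next
      case False
      then have "e * b\<^sup>2 \<le> e * ?N\<^sup>2"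
        using assms b by (intro mult_left_mono power_mono) auto
      also have "\<dots> \<le> ?Q"
        using x by (simp add: spiky_def)
      finally have "1 \<le> 1 / (e * b\<^sup>2) * ?Q"
        using assms b by (simp add: field_simps)
      then have "exp (- ?N) \<le> 1 / (e * b\<^sup>2) * ?Q * exp (- ?N)"
        by (metis exp_ge_zero mult_1 mult_right_mono)
      moreover have "0 \<le> exp b * exp (- (2 * ?N))" by simp
      ultimately show ?thesis unfolding mult.assoc by linarith
    qed
    then have "ennreal (exp (- ?N))
        \<le> ennreal (exp b * exp (- (2 * ?N)) + 1 / (e * b\<^sup>2) * (?Q * exp (- ?N)))"
      if "x \<in> spiky p e n"
      using that by (intro ennreal_leI) auto
    also have "ennreal (exp b * exp (- (2 * ?N)) + 1 / (e * b\<^sup>2) * (?Q * exp (- ?N)))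
        = ennreal (exp b) * ennreal (exp (- (2 * ?N)))
          + ennreal (1 / (e * b\<^sup>2)) * ennreal (?Q * exp (- ?N))"
    proof -
      have "ennreal (exp b * exp (- (2 * ?N))) = ennreal (exp b) * ennreal (exp (- (2 * ?N)))"
        by (rule ennreal_mult) auto
      moreover have "ennreal (1 / (e * b\<^sup>2) * (?Q * exp (- ?N)))
          = ennreal (1 / (e * b\<^sup>2)) * ennreal (?Q * exp (- ?N))"
        by (rule ennreal_mult) (use assms in auto)
      ultimately show ?thesis
        using assms by (subst ennreal_plus) auto
    qed
    finally show "indicator (spiky p e n) x * ennreal (exp (- ?N))
      \<le> ennreal (exp b) * ennreal (exp (- (2 * ?N)))
          + ennreal (1 / (e * b\<^sup>2)) * ennreal (?Q * exp (- ?N))"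
      by (simp add: indicator_def)
  qed
  also have "\<dots> = ennreal (exp b) * exp_integral p 2 ^ n
      + ennreal (1 / (e * b\<^sup>2)) * (of_nat n
        * (\<integral>\<^sup>+x. ennreal (\<bar>x\<bar> powr (2 * p) * exp (- (\<bar>x\<bar> powr p))) \<partial>lborel)
        * exp_integral p 1 ^ (n - 1))"
    by (simp add: nn_integral_add nn_integral_cmult nn_integral_power_sum_exp
        nn_integral_exp_power_sum del: ennreal_mult')
  finally show ?thesis unfolding b_def .
qed

lemma spiky_volume_ratio:
  assumes p: "1 \<le> p" and e: "0 < e"
  shows "\<exists>\<delta>. \<delta> \<longlonglongrightarrow> 0 \<and>
    (\<forall>n\<ge>1. emeasure (lebesgue_n n) (spiky p e n \<inter> p_ball p n)
      / emeasure (lebesgue_n n) (p_ball p n) \<le> ennreal (\<delta> n))"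
proof -
  define z where "z = enn2real (exp_integral p 1)"
  define m where "m = enn2real (\<integral>\<^sup>+x. ennreal (\<bar>x\<bar> powr (2 * p) * exp (- (\<bar>x\<bar> powr p))) \<partial>lborel)"
  \<comment> \<open>Every \<open>a\<close> strictly between 0 and \<open>ln 2 / p\<close> makes
    \<rho> less than 1; this is the midpoint, with \<rho> equal to
    \<open>exp (- ln 2 / (2 * p))\<close>.\<close>
  define a where "a = ln 2 / (2 * p)"
  define \<rho> where "\<rho> = exp a * 2 powr (- (1 / p))"
  \<comment> \<open>The two terms are those of \<open>nn_integral_exp_spiky_le\<close> divided by
    \<open>z ^ n\<close>, the integral of \<open>exp (- N)\<close>.\<close>
  define \<delta> where "\<delta> n = \<rho> ^ n + m / (z * e * a\<^sup>2) / real n" for n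
  have p0: "0 < p" using p by simp
  have a: "0 < a" using p by (simp add: a_def)
  have Z: "exp_integral p 1 = ennreal z"
    using exp_integral_finite[OF p] by (simp add: z_def)
  have z: "0 < z"
    using exp_integral_pos[OF p0] exp_integral_finite[OF p] by (simp add: z_def enn2real_positive_iff)
  have M: "(\<integral>\<^sup>+x. ennreal (\<bar>x\<bar> powr (2 * p) * exp (- (\<bar>x\<bar> powr p))) \<partial>lborel) = ennreal m"
    using second_moment_finite[OF p] by (simp add: m_def)
  have m: "0 \<le> m" by (simp add: m_def)
  have Z2: "exp_integral p 2 = ennreal (2 powr (- (1 / p)) * z)"
  proof -
    have "ennreal (2 powr (- (1 / p))) * ennreal z
        = ennreal (2 powr (- (1 / p)) * 2 powr (1 / p)) * exp_integral p 2"
      using exp_integral_scale[OF p0, of 2] Z by (simp add: ennreal_mult mult.assoc)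
    also have "2 powr (- (1 / p)) * 2 powr (1 / p) = (1::real)"
      by (simp flip: powr_add)
    finally show ?thesis using z by (simp add: ennreal_mult)
  qed
  have "\<rho> = exp (ln 2 * (1 / (2 * p) - 1 / p))"
    unfolding \<rho>_def a_def powr_def by (simp add: algebra_simps flip: exp_add)
  also have "\<dots> < 1"
    using p by (simp add: field_simps)
  finally have \<rho>: "0 < \<rho>" "\<rho> < 1"
    by (auto simp: \<rho>_def)
  have "\<delta> \<longlonglongrightarrow> 0 + 0"
    unfolding \<delta>_def[abs_def]
    by (intro tendsto_add LIMSEQ_power_zero lim_const_over_n) (use \<rho> in auto)
  moreover have "emeasure (lebesgue_n n) (spiky p e n \<inter> p_ball p n)
      / emeasure (lebesgue_n n) (p_ball p n) \<le> ennreal (\<delta> n)" if n: "1 \<le> n" for n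
  proof -
    let ?L = "lebesgue_n n"
    let ?V = "emeasure ?L (p_ball p n)" and ?W = "emeasure ?L (spiky p e n \<inter> p_ball p n)"
    let ?G = "cone_factor p n"
    have ball: "p_ball p n \<subseteq> space ?L"
      by (auto simp: p_ball_def)
    \<comment> \<open>The whole space is dilation-invariant as well, so the same formula evaluates
      the product for the full ball.\<close>
    have "?G * emeasure ?L (space ?L \<inter> p_ball p n)
        = (\<integral>\<^sup>+x. indicator (space ?L) x * ennreal (exp (- power_sum p n x)) \<partial>?L)"
      by (rule nn_integral_exp_cone[symmetric]) (auto simp: p0 dilate_in_space)
    also have "\<dots> = (\<integral>\<^sup>+x. ennreal (exp (- (1 * power_sum p n x))) \<partial>?L)"
      by (intro nn_integral_cong) simp
    also have "\<dots> = ennreal (z ^ n)"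
      using z by (subst nn_integral_exp_power_sum) (auto simp: Z ennreal_power)
    finally have GV: "?G * ?V = ennreal (z ^ n)"
      using ball by (simp add: Int_absorb1)
    \<comment> \<open>Cancelling in \<open>ennreal\<close> requires a factor that is neither zero
      nor infinite; this is read off from the product being a positive real.\<close>
    have "?G * ?V \<noteq> 0" "?G * ?V \<noteq> \<top>"
      unfolding GV using z by simp_all
    then have G: "?G \<noteq> 0" "?G \<noteq> \<top>" and V: "0 < ?V"
      by (auto simp: ennreal_mult_eq_top_iff zero_less_iff_neq_zero)
    have "?G * ?W = (\<integral>\<^sup>+x. indicator (spiky p e n) x * ennreal (exp (- power_sum p n x)) \<partial>?L)"
      by (rule nn_integral_exp_cone[symmetric]) (auto simp: p0 dilate_spiky_iff)
    also have "\<dots> \<le> ennreal (exp (real n * a)) * exp_integral p 2 ^ n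
      + ennreal (1 / (e * (real n * a)\<^sup>2)) * (of_nat n * ennreal m * exp_integral p 1 ^ (n - 1))"
      using nn_integral_exp_spiky_le[OF e a n, of p] unfolding M .
    also have "\<dots> = ennreal (exp (real n * a) * (2 powr (- (1 / p)) * z) ^ n
        + 1 / (e * (real n * a)\<^sup>2) * (real n * m * z ^ (n - 1)))"
      using z m e by (simp add: Z Z2 ennreal_power ennreal_of_nat_eq_real_of_nat
          flip: ennreal_mult ennreal_plus)
    also have "exp (real n * a) * (2 powr (- (1 / p)) * z) ^ n
        + 1 / (e * (real n * a)\<^sup>2) * (real n * m * z ^ (n - 1)) = z ^ n * \<delta> n"
    proof -
      have "exp (real n * a) * (2 powr (- (1 / p)) * z) ^ n = z ^ n * \<rho> ^ n"
        by (simp add: \<rho>_def power_mult_distrib exp_of_nat_mult)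
      moreover have "z ^ n = z * z ^ (n - 1)"
        using n by (cases n) auto
      then have "1 / (e * (real n * a)\<^sup>2) * (real n * m * z ^ (n - 1)) = z ^ n * (m / (z * e * a\<^sup>2) / real n)"
        using n z a e by (simp add: field_simps power2_eq_square)
      ultimately show ?thesis by (simp add: \<delta>_def algebra_simps)
    qed
    also have "ennreal (z ^ n * \<delta> n) = ennreal (z ^ n) * ennreal (\<delta> n)"
      by (rule ennreal_mult') (use z in simp)
    also have "\<dots> = ?G * (ennreal (\<delta> n) * ?V)"
      unfolding GV[symmetric] by (simp only: mult_ac)
    finally have "?W \<le> ennreal (\<delta> n) * ?V"
      using G by (simp add: ennreal_mult_le_mult_iff)
    then show ?thesis
      using V by (simp add: divide_le_posI_ennreal mult.commute)
  qed
  ultimately show ?thesis by (intro exI[of _ \<delta>]) simp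
qed

section \<open>Symmetric means and the cone measure\<close>

text \<open>The left side is a falling factorial, whose \<open>k\<close> factors lie between
  \<open>n - k\<close> and \<open>n\<close> when \<open>k \<le> n\<close>. This lemma and the next
  give the two resulting bounds on the normalisation of the symmetric means.\<close>

lemma binomial_fact_le_power: "real (n choose k) * fact k \<le> real n ^ k"
proof -
  have "(n choose k) * fact k \<le> n ^ k"
    using binomial_fact_pow by blast
  then show ?thesis
    by (metis of_nat_fact of_nat_le_iff of_nat_mult of_nat_power)
qed

lemma power_le_binomial_fact:
  assumes "k \<le> n"
  shows "(real n - real k) ^ k \<le> real (n choose k) * fact k"
proof -
  have "real (n choose k) * fact k = (\<Prod>i = 0..<k. real n - real i)"
    by (simp add: binomial_gbinomial gbinomial_prod_rev)
  moreover have "(\<Prod>i = 0..<k. real n - real k) \<le> (\<Prod>i = 0..<k. real n - real i)"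
    using assms by (intro prod_mono) auto
  ultimately show ?thesis by simp
qed

lemma sym_mean_eq:
  "sym_mean p n k x
    = (elem_sym k {1..n} (\<lambda>i. \<bar>x i\<bar> powr p) / real (n choose k)) powr (1 / (real k * p))"
  unfolding sym_mean_def elem_sym_def by (simp add: divide_inverse mult.commute)

lemma power_sum_double: "power_sum (2 * p) n x = (\<Sum>i=1..n. (\<bar>x i\<bar> powr p)\<^sup>2)"
  unfolding power_sum_def by (intro sum.cong) (auto simp: power2_eq_square simp flip: powr_add)

lemma power_powr_inverse:
  assumes "0 \<le> (x::real)" "1 \<le> k" "0 < p"
  shows "(x ^ k) powr (1 / (real k * p)) = x powr (1 / p)"
proof (cases "x = 0")
  case False
  then have "x ^ k = x powr real k"
    using assms by (simp add: powr_realpow)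
  then show ?thesis
    using assms by (simp add: powr_powr)
qed (use assms in \<open>simp add: power_0_left\<close>)

text \<open>Multiply numerator and denominator of the mean by \<open>fact k\<close>: the numerator
  becomes at most 1 and the denominator at least \<open>(n - k) ^ k\<close>, which is positive as
  \<open>k < n\<close>.\<close>

lemma sym_mean_le:
  assumes "0 < p" "1 \<le> k" "k < n" "power_sum p n x = 1"
  shows "sym_mean p n k x \<le> (1 / (real n - real k)) powr (1 / p)"
proof -
  let ?E = "elem_sym k {1..n} (\<lambda>i. \<bar>x i\<bar> powr p)"
  have E: "0 \<le> ?E" "fact k * ?E \<le> 1"
    using assms by (auto intro!: elem_sym_nonneg fact_elem_sym_le_1 simp: power_sum_def)
  have c: "0 < real (n choose k)"
    using assms by simp
  have pos: "0 < (real n - real k) ^ k" using assms by simp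
  have "?E / real (n choose k) = (fact k * ?E) / (real (n choose k) * fact k)"
    by simp
  also have "\<dots> \<le> 1 / (real n - real k) ^ k"
    using E pos power_le_binomial_fact[of k n] assms by (intro frac_le) auto
  also have "\<dots> = (1 / (real n - real k)) ^ k"
    by (simp add: power_divide)
  finally have "sym_mean p n k x \<le> ((1 / (real n - real k)) ^ k) powr (1 / (real k * p))"
    unfolding sym_mean_eq using E c assms by (intro powr_mono2) auto
  then show ?thesis
    using assms by (simp add: power_powr_inverse)
qed

text \<open>In the same quotient the numerator is at least \<open>d\<close> and the denominator at
  most \<open>n ^ k\<close>. A separate \<open>d\<close> allows choosing a value whose root is
  known.\<close>

lemma sym_mean_ge:
  assumes "0 < p" "1 \<le> k" "k \<le> n" "power_sum p n x = 1"
    and "0 \<le> d" "d \<le> 1 - (real k)\<^sup>2 * power_sum (2 * p) n x"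
  shows "(1 / real n) powr (1 / p) * d powr (1 / (real k * p)) \<le> sym_mean p n k x"
proof -
  let ?E = "elem_sym k {1..n} (\<lambda>i. \<bar>x i\<bar> powr p)"
  have "1 - (real k)\<^sup>2 * power_sum (2 * p) n x \<le> fact k * ?E"
    unfolding power_sum_double using assms by (intro fact_elem_sym_ge) (auto simp: power_sum_def)
  then have "d \<le> fact k * ?E" using assms by simp
  have c: "0 < real (n choose k)"
    using assms by simp
  have "(1 / real n) ^ k * d = d / real n ^ k"
    by (simp add: power_divide)
  also have "\<dots> \<le> (fact k * ?E) / (real (n choose k) * fact k)"
    using c \<open>d \<le> fact k * ?E\<close> assms binomial_fact_le_power[of n k] by (intro frac_le) auto
  also have "\<dots> = ?E / real (n choose k)"
    by simp
  finally have "((1 / real n) ^ k * d) powr (1 / (real k * p)) \<le> sym_mean p n k x"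
    unfolding sym_mean_eq using assms by (intro powr_mono2) auto
  then show ?thesis
    using assms by (simp add: powr_mult power_powr_inverse)
qed

lemma eventually_sym_mean_ge:
  assumes "1 \<le> k1" "k1 < k2" "1 \<le> p" "0 < c" "c < 1"
  obtains e where "0 < e" "\<forall>\<^sub>F n in sequentially. \<forall>x. power_sum p n x = 1 \<longrightarrow>
    power_sum (2 * p) n x < e \<longrightarrow> c * sym_mean p n k1 x \<le> sym_mean p n k2 x"
proof -
  \<comment> \<open>The constant splits as \<open>c = sqrt c * sqrt c\<close>. One factor pays for
    the deficit of the mean of order \<open>k2\<close>: the root of \<open>d\<close> is
    \<open>sqrt c\<close>, and \<open>e\<close> solves \<open>k2^2 * e = 1 - d\<close>.\<close>
  define d where "d = sqrt c powr (real k2 * p)"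
  define e where "e = (1 - d) / (real k2)\<^sup>2"
  have sc: "0 < sqrt c" "sqrt c < 1" using assms by auto
  have kp: "0 < k2" "0 < real k2 * p" "0 < p" using assms by auto
  have d: "0 \<le> d" "d < 1"
    unfolding d_def using sc kp powr_less_mono2[of "real k2 * p" "sqrt c" 1] by auto
  have root: "d powr (1 / (real k2 * p)) = sqrt c"
    unfolding d_def powr_powr using sc kp by simp
  have e: "0 < e"
    unfolding e_def using d assms by simp
  \<comment> \<open>The other factor \<open>sqrt c\<close> pays for having \<open>n - k1\<close>
    instead of \<open>n\<close> in the upper bound on the mean of order \<open>k1\<close>.\<close>
  have "((\<lambda>n. (1 - real k1 / real n) powr (1 / p)) \<longlongrightarrow> (1 - 0) powr (1 / p)) sequentially"
    by (intro tendsto_powr tendsto_diff tendsto_const lim_const_over_n) auto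
  then have "\<forall>\<^sub>F n in sequentially. sqrt c < (1 - real k1 / real n) powr (1 / p)"
    by (rule order_tendstoD) (use sc in simp)
  then have "\<forall>\<^sub>F n in sequentially. \<forall>x. power_sum p n x = 1 \<longrightarrow>
    power_sum (2 * p) n x < e \<longrightarrow> c * sym_mean p n k1 x \<le> sym_mean p n k2 x"
    using eventually_ge_at_top[of k2]
  proof eventually_elim
    case (elim n)
    show ?case
    proof (intro allI impI)
      fix x assume x: "power_sum p n x = 1" "power_sum (2 * p) n x < e"
      have n: "0 < real n - real k1" "0 < real n" using elim assms by auto
      have "(real k2)\<^sup>2 * power_sum (2 * p) n x \<le> (real k2)\<^sup>2 * e"
        using x by (intro mult_left_mono) auto
      also have "\<dots> = 1 - d"
        unfolding e_def using assms by simp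
      finally have low: "(1 / real n) powr (1 / p) * sqrt c \<le> sym_mean p n k2 x"
        using sym_mean_ge[of p k2 n x d] x d kp elim assms root by simp
      have "c * sym_mean p n k1 x \<le> c * (1 / (real n - real k1)) powr (1 / p)"
        using sym_mean_le[of p k1 n x] x kp elim assms by (intro mult_left_mono) auto
      also have "\<dots> = sqrt c * (sqrt c * (1 / (real n - real k1)) powr (1 / p))"
        using assms by simp
      also have "\<dots> \<le> sqrt c * ((1 - real k1 / real n) powr (1 / p)
          * (1 / (real n - real k1)) powr (1 / p))"
        using elim sc by (intro mult_left_mono mult_right_mono) auto
      also have "(1 - real k1 / real n) powr (1 / p) * (1 / (real n - real k1)) powr (1 / p)
          = ((1 - real k1 / real n) * (1 / (real n - real k1))) powr (1 / p)"
        using n by (intro powr_mult[symmetric])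
      also have "(1 - real k1 / real n) * (1 / (real n - real k1)) = 1 / real n"
        using n by (simp add: field_simps)
      finally show "c * sym_mean p n k1 x \<le> sym_mean p n k2 x"
        using low by (simp add: mult.commute)
    qed
  qed
  with e show ?thesis using that by blast
qed

section \<open>From the sphere to the law of the random vector\<close>

lemma p_sphere_eq:
  assumes "0 < p"
  shows "p_sphere p n = {x \<in> space (lebesgue_n n). power_sum p n x = 1}"
proof -
  have "s powr (1 / p) = 1 \<longleftrightarrow> s = 1" if "0 \<le> s" for s :: real
  proof
    assume "s powr (1 / p) = 1"
    then have "(s powr (1 / p)) powr p = 1" by simp
    then show "s = 1" using that assms by (simp add: powr_powr)
  qed simp
  then show ?thesis
    unfolding p_sphere_def p_norm_def power_sum_def by (auto simp: sum_nonneg)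
qed

lemma cone_over_spiky_subset:
  assumes p: "0 < p" and A: "A \<subseteq> p_sphere p n" "A \<subseteq> spiky p e n"
  shows "cone_over n A \<subseteq> spiky p e n \<inter> p_ball p n"
proof
  fix y assume "y \<in> cone_over n A"
  then obtain r a where y: "y = dilate n r a" and r: "0 \<le> r" "r \<le> 1" and a: "a \<in> A"
    unfolding cone_over_def dilate_def by auto
  have a1: "a \<in> space (lebesgue_n n)" "power_sum p n a = 1"
    using a A p by (auto simp: p_sphere_eq)
  show "y \<in> spiky p e n \<inter> p_ball p n"
  proof (cases "r = 0")
    \<comment> \<open>The apex of the cone: all power sums vanish at the origin, so the inequality
      in \<open>spiky\<close> reads 0 \<le> 0. The scaling lemmas cover only
      \<open>0 < r\<close>.\<close>
    case True
    then have "power_sum q n y = 0" for q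
      by (simp add: y dilate_def power_sum_def)
    then show ?thesis
      using p by (simp add: y spiky_def p_ball_eq dilate_in_space)
  next
    case False
    then show ?thesis
      using r a a1 A p
      by (auto simp: y dilate_spiky_iff p_ball_eq dilate_in_space power_sum_dilate powr_le1)
  qed
qed

text \<open>\<open>measure_of\<close> yields the null measure when its set function is not a measure, so this bound
  does not require countable additivity of the cone volume.\<close>

lemma emeasure_cone_measure_le:
  "emeasure (cone_measure p n) A
    \<le> emeasure (lebesgue_n n) (cone_over n A) / emeasure (lebesgue_n n) (p_ball p n)"
  unfolding cone_measure_def emeasure_measure_of_conv by simp

text \<open>Pulling \<open>B\<close> back along the inclusion of the sphere leaves
  \<open>B Int p_sphere p n\<close>, whose cone is enclosed in the set of the volume estimate. This
  turns the probability of a bad event into a volume share.\<close>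

lemma cone_distributed_emeasure_le:
  assumes cd: "cone_distributed M X p n" and p: "0 < p"
    and B: "B \<in> sets (lebesgue_n n)" "B \<inter> p_sphere p n \<subseteq> spiky p e n"
  shows "emeasure M (X -` B \<inter> space M)
    \<le> emeasure (lebesgue_n n) (spiky p e n \<inter> p_ball p n) / emeasure (lebesgue_n n) (p_ball p n)"
proof -
  let ?L = "lebesgue_n n" and ?C = "cone_measure p n"
  have ball [measurable]: "p_ball p n \<in> sets ?L"
    unfolding p_ball_eq[OF p] by measurable
  have sub: "p_sphere p n \<subseteq> space ?L"
    by (auto simp: p_sphere_def)
  have space: "space ?C = p_sphere p n"
    unfolding cone_measure_def
    by (intro space_measure_of) (auto simp: sets_restrict_space)
  \<comment> \<open>The generator is already a sigma-algebra on the sphere, so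
    \<open>measure_of\<close> adds no sets.\<close>
  have sets: "sets ?C = sets (restrict_space ?L (p_sphere p n))"
  proof -
    have "space (restrict_space ?L (p_sphere p n)) = p_sphere p n"
      using sub by (simp add: space_restrict_space Int_absorb2)
    then show ?thesis
      unfolding cone_measure_def by (metis sets.sets_measure_of_eq)
  qed
  have id: "(\<lambda>x. x) \<in> measurable ?C ?L"
    unfolding measurable_cong_sets[OF sets refl] by (rule measurable_restrict_space1) simp
  have "emeasure M (X -` B \<inter> space M) = emeasure (distr M ?L X) B"
    by (rule emeasure_distr[symmetric]) (use cd B in \<open>auto simp: cone_distributed_def\<close>)
  also have "\<dots> = emeasure ?C (B \<inter> p_sphere p n)"
    using cd B id emeasure_distr[OF id B(1)] by (simp add: cone_distributed_def space)
  also have "\<dots> \<le> emeasure ?L (cone_over n (B \<inter> p_sphere p n)) / emeasure ?L (p_ball p n)"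
    by (rule emeasure_cone_measure_le)
  \<comment> \<open>Monotonicity asks for measurability of the enclosing set, which holds for
    \<open>spiky p e n\<close> and the ball.\<close>
  also have "\<dots> \<le> emeasure ?L (spiky p e n \<inter> p_ball p n) / emeasure ?L (p_ball p n)"
    using B p by (intro divide_right_mono_ennreal emeasure_mono cone_over_spiky_subset) auto
  finally show ?thesis .
qed

lemma sym_mean_measurable [measurable]: "sym_mean p n k \<in> borel_measurable (lebesgue_n n)"
proof -
  have "(\<lambda>x. \<Prod>i\<in>I. \<bar>x i\<bar> powr p) \<in> borel_measurable (lebesgue_n n)" if "I \<subseteq> {1..n}" for I
  proof (rule borel_measurable_prod)
    fix i assume "i \<in> I"
    then have [measurable]: "(\<lambda>x. x i) \<in> borel_measurable (lebesgue_n n)"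
      using that measurable_component_singleton[of i "{1..n}" "\<lambda>_. lborel"]
      unfolding lebesgue_n_def by auto
    show "(\<lambda>x. \<bar>x i\<bar> powr p) \<in> borel_measurable (lebesgue_n n)"
      by measurable
  qed
  then have [measurable]: "(\<lambda>x. \<Sum>I | I \<subseteq> {1..n} \<and> card I = k. \<Prod>i\<in>I. \<bar>x i\<bar> powr p)
      \<in> borel_measurable (lebesgue_n n)"
    by (intro borel_measurable_sum) auto
  show ?thesis
    unfolding sym_mean_def[abs_def] by measurable
qed

theorem corollary1p3:
  fixes k1 k2 :: nat and p c :: real
    and M :: "nat \<Rightarrow> 'a measure" and X :: "nat \<Rightarrow> 'a \<Rightarrow> nat \<Rightarrow> real"
  assumes "1 \<le> k1" and "k1 < k2" and "1 \<le> p"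
    and "\<And>n. k2 \<le> n \<Longrightarrow> prob_space (M n)"
    and "\<And>n. k2 \<le> n \<Longrightarrow> cone_distributed (M n) (X n) p n"
    and "0 < c" and "c < 1"
  shows "(\<lambda>n. \<P>(\<omega> in M n. sym_mean p n k2 (X n \<omega>) \<ge> c * sym_mean p n k1 (X n \<omega>)))
           \<longlonglongrightarrow> 1"
proof -
  have p: "0 < p" using assms by simp
  obtain e where e: "0 < e" and ev: "\<forall>\<^sub>F n in sequentially. \<forall>x. power_sum p n x = 1 \<longrightarrow>
    power_sum (2 * p) n x < e \<longrightarrow> c * sym_mean p n k1 x \<le> sym_mean p n k2 x"
    by (rule eventually_sym_mean_ge[OF assms(1-3) assms(6,7)])
  obtain \<delta> where \<delta>: "\<delta> \<longlonglongrightarrow> 0" and vol: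
      "\<forall>n\<ge>1. emeasure (lebesgue_n n) (spiky p e n \<inter> p_ball p n)
        / emeasure (lebesgue_n n) (p_ball p n) \<le> ennreal (\<delta> n)"
    using spiky_volume_ratio[OF assms(3) e] by (elim exE conjE)
  let ?P = "\<lambda>n. \<P>(\<omega> in M n. sym_mean p n k2 (X n \<omega>) \<ge> c * sym_mean p n k1 (X n \<omega>))"
  have bounds: "\<forall>\<^sub>F n in sequentially. 1 - \<bar>\<delta> n\<bar> \<le> ?P n \<and> ?P n \<le> 1"
    using ev eventually_ge_at_top[of k2]
  proof eventually_elim
    case (elim n)
    let ?L = "lebesgue_n n"
    interpret prob_space "M n" using elim(2) by (rule assms(4))
    have cd: "cone_distributed (M n) (X n) p n" using elim(2) by (rule assms(5))
    then have X: "X n \<in> measurable (M n) ?L"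
      by (simp add: cone_distributed_def)
    define B where "B = space ?L - {x \<in> space ?L. c * sym_mean p n k1 x \<le> sym_mean p n k2 x}"
    have B: "B \<in> sets ?L"
      unfolding B_def
      by (intro sets.compl_sets borel_measurable_le borel_measurable_times borel_measurable_const
          sym_mean_measurable)
    \<comment> \<open>By the choice of \<open>e\<close>, failure of the inequality at a point of the
      sphere forces Q \<ge> e, which is membership in \<open>spiky\<close> because N = 1
      there.\<close>
    have "B \<inter> p_sphere p n \<subseteq> spiky p e n"
    proof
      fix x assume x: "x \<in> B \<inter> p_sphere p n"
      then have "x \<in> space ?L" "power_sum p n x = 1"
        "\<not> c * sym_mean p n k1 x \<le> sym_mean p n k2 x"
        unfolding B_def p_sphere_eq[OF p] by blast+
      moreover from this have "\<not> power_sum (2 * p) n x < e"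
        using elim(1) by blast
      ultimately show "x \<in> spiky p e n"
        by (simp add: spiky_def)
    qed
    then have "emeasure (M n) (X n -` B \<inter> space (M n))
        \<le> emeasure ?L (spiky p e n \<inter> p_ball p n) / emeasure ?L (p_ball p n)"
      by (rule cone_distributed_emeasure_le[OF cd p B])
    also have "\<dots> \<le> ennreal (\<delta> n)"
      by (rule vol[rule_format]) (use elim(2) assms(1,2) in linarith)
    \<comment> \<open>\<open>spiky_volume_ratio\<close> says nothing about the sign of \<delta>, and
      \<open>ennreal\<close> sends negative reals to 0; the absolute value makes the passage to a
      real bound valid.\<close>
    also have "\<dots> \<le> ennreal \<bar>\<delta> n\<bar>"
      by (intro ennreal_leI) simp
    finally have "prob (X n -` B \<inter> space (M n)) \<le> \<bar>\<delta> n\<bar>"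
      by (simp add: emeasure_eq_measure)
    moreover define E where
      "E = {\<omega> \<in> space (M n). sym_mean p n k2 (X n \<omega>) \<ge> c * sym_mean p n k1 (X n \<omega>)}"
    have "X n -` B \<inter> space (M n) = space (M n) - E"
      using measurable_space[OF X] by (auto simp: B_def E_def)
    moreover have "E \<in> events"
      unfolding E_def
      by (intro borel_measurable_le borel_measurable_times borel_measurable_const
          measurable_compose[OF X sym_mean_measurable])
    ultimately have "1 - prob E \<le> \<bar>\<delta> n\<bar>"
      by (simp only: prob_compl)
    then show ?case
      using prob_le_1[of E] unfolding E_def by linarith
  qed
  have "(\<lambda>n. 1 - \<bar>\<delta> n\<bar>) \<longlonglongrightarrow> 1 - \<bar>0\<bar>"
    by (intro tendsto_diff tendsto_const tendsto_rabs \<delta>)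
  then have lim: "(\<lambda>n. 1 - \<bar>\<delta> n\<bar>) \<longlonglongrightarrow> 1" by simp
  have "\<forall>\<^sub>F n in sequentially. 1 - \<bar>\<delta> n\<bar> \<le> ?P n" "\<forall>\<^sub>F n in sequentially. ?P n \<le> 1"
    using bounds by (simp_all add: eventually_conj_iff)
  then show ?thesis
    by (rule tendsto_sandwich[OF _ _ lim tendsto_const])
qed

end
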